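(* Let $E$ be a Banach lattice with order continuous norm. The following conditions are equivalent. (i) $E$ is a KB-space. (ii) Every bounded operator $T:E\to E$ is KB. (iii) Every positive operator $T:E\to E$ is KB. (iv) Every positive weakly compact operator $T:E\to E$ is KB. (v) Every positive compact operator $T:E\to E$ is KB.
   Context: All vector spaces are real and all operators are linear and bounded. For a Banach lattice $E$, $B_E$ is the closed unit ball of $E$, $E_+$ the positive cone, and $(B_E)_+=B_E\cap E_+$. A Banach lattice is a KB-space if every norm bounded increasing sequence (equivalently, net) in $E_+$ is norm convergent. Let $E$ be a Banach lattice and $Y$ a Banach space. A bounded operator $T:E\to Y$ is called KB if for every increasing net $(x_\alpha)$ in $(B_E)_+$ there exists $x\in E$ such that $\|Tx_\alpha-Tx\|\to 0$. (Here $x$ need not be an upper bound or a limit of $(x_\alpha)$.) *)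

theory Defs
  imports "HOL-Analysis.Analysis" "HOL-Library.Lattice_Algebras"
begin

class banach_lattice = banach + ordered_real_vector + lattice_ab_group_add_abs +
  assumes norm_le_of_abs_le: "\<bar>x\<bar> \<le> \<bar>y\<bar> \<Longrightarrow> norm x \<le> norm y"

instance real :: banach_lattice
  by standard simp

definition directed_preorder :: "'i set \<Rightarrow> ('i \<Rightarrow> 'i \<Rightarrow> bool) \<Rightarrow> bool" where
  "directed_preorder I le \<longleftrightarrow>
     I \<noteq> {} \<and> reflp_on I le \<and> transp_on I le \<and>
     (\<forall>i\<in>I. \<forall>j\<in>I. \<exists>k\<in>I. le i k \<and> le j k)"

definition tails :: "'i set \<Rightarrow> ('i \<Rightarrow> 'i \<Rightarrow> bool) \<Rightarrow> 'i filter" where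
  "tails I le = (INF i\<in>I. principal {j \<in> I. le i j})"

lemma eventually_tails:
  assumes "directed_preorder I le"
  shows "eventually P (tails I le) \<longleftrightarrow> (\<exists>i\<in>I. \<forall>j\<in>I. le i j \<longrightarrow> P j)"
proof -
  have I: "I \<noteq> {}" using assms by (simp add: directed_preorder_def)
  have "\<exists>k\<in>I. principal {l \<in> I. le k l} \<le> inf (principal {l \<in> I. le i l}) (principal {l \<in> I. le j l})"
    if ij: "i \<in> I" "j \<in> I" for i j
  proof -
    obtain k where k: "k \<in> I" "le i k" "le j k"
      using assms ij unfolding directed_preorder_def by blast
    have "le i l" "le j l" if "l \<in> I" "le k l" for l
      using assms ij k that unfolding directed_preorder_def by (meson transp_onD)+
    then show ?thesis using k(1) by (intro bexI[of _ k]) auto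
  qed
  then show ?thesis
    unfolding tails_def by (subst eventually_INF_base[OF I]) (auto simp: eventually_principal)
qed

text \<open>HOL cannot quantify over index types inside a definition. The two definitions below that
  speak about nets in a lattice therefore let the index sets range over all directed preorders
  carried by subsets of the lattice itself. This is no restriction, because a monotone net is
  indexed, up to reparametrisation, by its own range; see the lemmas following the definitions.\<close>

definition order_continuous_norm :: "'a::banach_lattice itself \<Rightarrow> bool" where
  "order_continuous_norm _ \<longleftrightarrow>
     (\<forall>(I :: 'a set) le (x :: 'a \<Rightarrow> 'a).
        directed_preorder I le \<and> monotone_on I le (\<ge>) x \<and>
        (\<forall>z. (\<forall>i\<in>I. z \<le> x i) \<longleftrightarrow> z \<le> 0) \<longrightarrow>
        ((\<lambda>i. norm (x i)) \<longlongrightarrow> 0) (tails I le))"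

definition KB_space :: "'a::banach_lattice itself \<Rightarrow> bool" where
  "KB_space _ \<longleftrightarrow>
     (\<forall>x :: nat \<Rightarrow> 'a. incseq x \<and> (\<forall>n. 0 \<le> x n) \<and> bounded (range x) \<longrightarrow> convergent x)"

definition KB_operator :: "('a::banach_lattice \<Rightarrow> 'b::banach) \<Rightarrow> bool" where
  "KB_operator T \<longleftrightarrow> bounded_linear T \<and>
     (\<forall>(I :: 'a set) le (x :: 'a \<Rightarrow> 'a).
        directed_preorder I le \<and> monotone_on I le (\<le>) x \<and>
        x ` I \<subseteq> cball 0 1 \<inter> {0..} \<longrightarrow>
        (\<exists>z. ((\<lambda>i. norm (T (x i) - T z)) \<longlongrightarrow> 0) (tails I le)))"

lemma directed_range:
  assumes "directed_preorder I le" "monotone_on I le r x" "reflp r" "transp r"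
  shows "directed_preorder (x ` I) r"
  unfolding directed_preorder_def
proof (intro conjI ballI)
  show "x ` I \<noteq> {}" using assms(1) by (simp add: directed_preorder_def)
  show "reflp_on (x ` I) r" "transp_on (x ` I) r"
    using assms(3,4) by (auto intro: reflp_on_subset transp_on_subset)
  fix a b assume "a \<in> x ` I" "b \<in> x ` I"
  then obtain i j where ij: "i \<in> I" "j \<in> I" "a = x i" "b = x j" by auto
  then obtain k where "k \<in> I" "le i k" "le j k"
    using assms(1) unfolding directed_preorder_def by blast
  then show "\<exists>c\<in>x ` I. r a c \<and> r b c"
    using ij assms(2) by (auto dest: monotone_onD)
qed

lemma tendsto_tails_range:
  assumes "directed_preorder I le" "monotone_on I le r x" "reflp r" "transp r"
    and "(f \<longlongrightarrow> c) (tails (x ` I) r)"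
  shows "((\<lambda>i. f (x i)) \<longlongrightarrow> c) (tails I le)"
proof -
  have "filterlim x (tails (x ` I) r) (tails I le)"
    unfolding filterlim_iff eventually_tails[OF directed_range[OF assms(1-4)]]
      eventually_tails[OF assms(1)]
    using assms(2) by (fastforce dest: monotone_onD)
  with assms(5) show ?thesis by (rule filterlim_compose)
qed

lemma order_continuous_norm_net:
  fixes x :: "'i \<Rightarrow> 'a::banach_lattice"
  assumes "order_continuous_norm TYPE('a)" "directed_preorder I le" "monotone_on I le (\<ge>) x"
    and "\<And>z. (\<forall>i\<in>I. z \<le> x i) \<longleftrightarrow> z \<le> 0"
  shows "((\<lambda>i. norm (x i)) \<longlongrightarrow> 0) (tails I le)"
proof -
  have r: "reflp ((\<ge>) :: 'a \<Rightarrow> _)" "transp ((\<ge>) :: 'a \<Rightarrow> _)"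
    by (auto intro: reflpI transpI)
  have "(norm \<longlongrightarrow> 0) (tails (x ` I) (\<ge>))"
    using assms(1)[unfolded order_continuous_norm_def, rule_format, of "x ` I" "(\<ge>)" "\<lambda>y. y"]
      directed_range[OF assms(2,3) r] assms(4) by (auto simp: monotone_on_def)
  then show ?thesis by (rule tendsto_tails_range[OF assms(2,3) r])
qed

lemma KB_operator_net:
  fixes x :: "'i \<Rightarrow> 'a::banach_lattice"
  assumes "KB_operator T" "directed_preorder I le" "monotone_on I le (\<le>) x"
    and "x ` I \<subseteq> cball 0 1 \<inter> {0..}"
  shows "\<exists>z. ((\<lambda>i. norm (T (x i) - T z)) \<longlongrightarrow> 0) (tails I le)"
proof -
  have r: "reflp ((\<le>) :: 'a \<Rightarrow> _)" "transp ((\<le>) :: 'a \<Rightarrow> _)"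
    by (auto intro: reflpI transpI)
  obtain z where "((\<lambda>y. norm (T y - T z)) \<longlongrightarrow> 0) (tails (x ` I) (\<le>))"
    using assms(1)[unfolded KB_operator_def, THEN conjunct2, rule_format,
        of "x ` I" "(\<le>)" "\<lambda>y. y"]
      directed_range[OF assms(2,3) r] assms(4) by (auto simp: monotone_on_def)
  then show ?thesis using tendsto_tails_range[OF assms(2,3) r] by blast
qed

definition positive_operator :: "('a::banach_lattice \<Rightarrow> 'b::banach_lattice) \<Rightarrow> bool" where
  "positive_operator T \<longleftrightarrow> bounded_linear T \<and> (\<forall>x\<ge>0. 0 \<le> T x)"

definition compact_operator :: "('a::banach \<Rightarrow> 'b::banach) \<Rightarrow> bool" where
  "compact_operator T \<longleftrightarrow> bounded_linear T \<and> compact (closure (T ` cball 0 1))"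

definition weak_topology :: "'a::real_normed_vector topology" where
  "weak_topology =
     topology_generated_by {f -` U | (f :: 'a \<Rightarrow> real) U. bounded_linear f \<and> open U}"

definition weakly_compact_operator :: "('a::banach \<Rightarrow> 'b::banach) \<Rightarrow> bool" where
  "weakly_compact_operator T \<longleftrightarrow> bounded_linear T \<and>
     compactin weak_topology (weak_topology closure_of (T ` cball 0 1))"

end

theory Submission
  imports Defs
begin

text \<open>In a KB-space increasing bounded nets converge in norm, so every bounded operator is KB.
  Conversely let \<open>x\<close> be an increasing norm bounded divergent sequence. By order
  continuity \<open>inf (x m) y\<close> is Cauchy in \<open>m\<close> for every \<open>y\<close>, hence
  \<open>pprt (x m - c *\<^sub>R x n)\<close> does not become small for large \<open>m\<close>, and along a
  fast subsequence \<open>z\<close> of \<open>x\<close> one can disjointify: there are pairwise disjoint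
  \<open>w k\<close> with \<open>0 \<le> w k \<le> z (Suc k)\<close> and norms bounded below. Hahn--Banach
  yields positive functionals \<open>f k\<close> of norm at most one that are carried by \<open>w k\<close>
  and satisfy \<open>f k (w k) = norm (w k)\<close>; disjointness and order continuity give
  \<open>f k p \<longlonglongrightarrow> 0\<close> for every \<open>p\<close>. The operator
  \<open>T x = (\<Sum>k. f k x *\<^sub>R (1/2) ^ k *\<^sub>R w k)\<close> is positive and compact. If
  \<open>T (z n) \<longlonglongrightarrow> T p\<close>, then comparing coefficients gives
  \<open>f k (z n) \<longlonglongrightarrow> f k p\<close>, so \<open>f k p\<close> is bounded away from zero, a
  contradiction.\<close>

subsection \<open>Hahn--Banach via minimal sublinear functionals\<close>

definition sublinear :: "('a::real_vector \<Rightarrow> real) \<Rightarrow> bool" where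
  "sublinear p \<longleftrightarrow> (\<forall>x y. p (x + y) \<le> p x + p y) \<and> (\<forall>c\<ge>0. \<forall>x. p (c *\<^sub>R x) = c * p x)"

lemma sublinearD:
  assumes "sublinear p"
  shows "p (x + y) \<le> p x + p y" "0 \<le> c \<Longrightarrow> p (c *\<^sub>R x) = c * p x" "p 0 = 0" "- p (- x) \<le> p x"
proof -
  show *: "p (x + y) \<le> p x + p y" "0 \<le> c \<Longrightarrow> p (c *\<^sub>R x) = c * p x" for x y c
    using assms by (auto simp: sublinear_def)
  show z: "p 0 = 0" using *(2)[of 0 0] by simp
  show "- p (- x) \<le> p x" using *(1)[of x "- x"] z by simp
qed

text \<open>One inequality for positive scalars suffices: applied to \<open>inverse c\<close> and
  \<open>c *\<^sub>R x\<close> it yields the reverse one.\<close>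

lemma sublinearI:
  assumes "\<And>x y. p (x + y) \<le> p x + p y" "p 0 = 0" "\<And>c x. 0 < c \<Longrightarrow> p (c *\<^sub>R x) \<le> c * p x"
  shows "sublinear p"
proof -
  have "p (c *\<^sub>R x) = c * p x" if "0 \<le> c" for c x
  proof (cases "c = 0")
    case False
    with that have c: "0 < c" by simp
    have "p x \<le> inverse c * p (c *\<^sub>R x)"
      using assms(3)[of "inverse c" "c *\<^sub>R x"] c by simp
    then have "c * p x \<le> p (c *\<^sub>R x)"
      using c by (simp add: field_simps)
    then show ?thesis using assms(3)[OF c, of x] by simp
  qed (simp add: assms(2))
  then show ?thesis using assms(1) by (simp add: sublinear_def)
qed

text \<open>A minimal sublinear functional \<open>q\<close> coincides with the functional \<open>r\<close> obtained
  here, so it is odd and therefore linear.\<close>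
lemma sublinear_shrink:
  fixes q :: "'a::real_vector \<Rightarrow> real"
  assumes q: "sublinear q"
  obtains r where "sublinear r" "\<And>x. r x \<le> q x" "r (- u) \<le> - q u"
proof
  \<comment> \<open>The value \<open>t = 0\<close> gives \<open>r x \<le> q x\<close>; the value
    \<open>t = 1\<close> at \<open>- u\<close> gives \<open>q 0 - q u\<close>, which is
    \<open>- q u\<close>.\<close>
  define r where "r x = (INF t\<in>{0..}. q (x + t *\<^sub>R u) - t * q u)" for x
  \<comment> \<open>A lower bound independent of \<open>t\<close>, so the infimum is finite.\<close>
  have low: "- q (- x) \<le> q (x + t *\<^sub>R u) - t * q u" if "0 \<le> t" for x t
    using sublinearD(1)[OF q, of "x + t *\<^sub>R u" "- x"] sublinearD(2)[OF q that, of u] by simp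
  have bdd: "bdd_below ((\<lambda>t. q (x + t *\<^sub>R u) - t * q u) ` {0..})" for x
    using low by (intro bdd_belowI2) auto
  have le: "r x \<le> q (x + t *\<^sub>R u) - t * q u" if "0 \<le> t" for x t
    unfolding r_def using that by (intro cINF_lower[OF bdd]) auto
  have ge: "a \<le> r x" if "\<And>t. 0 \<le> t \<Longrightarrow> a \<le> q (x + t *\<^sub>R u) - t * q u" for a x
    unfolding r_def using that by (intro cINF_greatest) auto
  show "r x \<le> q x" for x using le[of 0 x] by simp
  show "r (- u) \<le> - q u" using le[of 1 "- u"] sublinearD(3)[OF q] by simp
  show "sublinear r"
  proof (rule sublinearI)
    fix x y
    have *: "r (x + y) \<le> (q (x + s *\<^sub>R u) - s * q u) + (q (y + t *\<^sub>R u) - t * q u)"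
      if "0 \<le> s" "0 \<le> t" for s t
      using le[of "s + t" "x + y"] sublinearD(1)[OF q, of "x + s *\<^sub>R u" "y + t *\<^sub>R u"] that
      by (simp add: algebra_simps)
    \<comment> \<open>The two infima are taken one after the other: over \<open>t\<close> with
      \<open>s\<close> fixed, then over \<open>s\<close>.\<close>
    have "r (x + y) - (q (x + s *\<^sub>R u) - s * q u) \<le> r y" if "0 \<le> s" for s
      by (rule ge) (use *[OF that] in \<open>simp only: diff_le_eq add.commute\<close>)
    then have "r (x + y) - r y \<le> r x" by (intro ge) (simp add: algebra_simps)
    then show "r (x + y) \<le> r x + r y" by simp
  next
    show "r 0 = 0"
      using low[of _ 0] le[of 0 0] sublinearD(3)[OF q] ge[of 0 0] by (intro antisym) auto
  next
    fix c :: real and x assume c: "0 < c"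
    have "r (c *\<^sub>R x) \<le> c * (q (x + t *\<^sub>R u) - t * q u)" if "0 \<le> t" for t
      using le[of "c * t" "c *\<^sub>R x"] sublinearD(2)[OF q, of c "x + t *\<^sub>R u"] c that
      by (simp add: algebra_simps)
    then have "inverse c * r (c *\<^sub>R x) \<le> r x" using c by (intro ge) (simp add: field_simps)
    then show "r (c *\<^sub>R x) \<le> c * r x" using c by (simp add: field_simps)
  qed
qed

text \<open>Zorn's lemma for the reversed pointwise order: the pointwise infimum of a nonempty chain
  of sublinear functionals below \<open>p\<close> is again one.\<close>

lemma minimal_sublinear:
  fixes p :: "'a::real_vector \<Rightarrow> real"
  assumes p: "sublinear p"
  obtains m where "sublinear m" "m \<le> p" "\<And>q. sublinear q \<Longrightarrow> q \<le> m \<Longrightarrow> q = m"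
proof -
  define A where "A = {q. sublinear q \<and> q \<le> p}"
  have "\<exists>m\<in>A. \<forall>a\<in>A. (a \<le> m) \<longrightarrow> a = m"
  proof (rule predicate_Zorn[where P="\<lambda>a b. b \<le> a"])
    show "partial_order_on A (relation_of (\<lambda>a b. b \<le> a) A)"
      by (rule partial_order_on_relation_ofI) auto
    fix C assume C: "C \<in> Chains (relation_of (\<lambda>a b. b \<le> a) A)"
    have tot: "a \<le> b \<or> b \<le> a" if "a \<in> C" "b \<in> C" for a b
      using C that by (auto simp: Chains_def relation_of_def)
    have CA: "C \<subseteq> A" using C by (auto simp: Chains_def relation_of_def)
    show "\<exists>u\<in>A. \<forall>a\<in>C. u \<le> a"
    proof (cases "C = {}")
      case True
      then show ?thesis using p by (auto simp: A_def)
    next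
      case False
      define r where "r x = (INF q\<in>C. q x)" for x
      have sub: "sublinear q" "q \<le> p" if "q \<in> C" for q using that CA by (auto simp: A_def)
      \<comment> \<open>Every member of the chain is bounded below by a quantity depending on
        \<open>p\<close> only, so the pointwise infimum is finite.\<close>
      have "- p (- x) \<le> q x" if "q \<in> C" for q x
        using sublinearD(4)[OF sub(1)[OF that], of x] le_funD[OF sub(2)[OF that], of "- x"] by simp
      then have bdd: "bdd_below ((\<lambda>q. q x) ` C)" for x by (intro bdd_belowI2) auto
      have le: "r x \<le> q x" if "q \<in> C" for x q
        unfolding r_def using that by (intro cINF_lower[OF bdd]) auto
      have ge: "a \<le> r x" if "\<And>q. q \<in> C \<Longrightarrow> a \<le> q x" for a x
        unfolding r_def using that False by (intro cINF_greatest) auto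
      have "sublinear r"
      proof (rule sublinearI)
        fix x y
        have *: "r (x + y) \<le> a x + b y" if ab: "a \<in> C" "b \<in> C" for a b
        proof -
          \<comment> \<open>In a chain the smaller of \<open>a\<close> and \<open>b\<close> bounds
            both terms at once, which reduces the claim to subadditivity of a single
            functional.\<close>
          obtain c where c: "c \<in> C" "c \<le> a" "c \<le> b" using tot[OF ab] ab by auto
          have "r (x + y) \<le> c (x + y)" by (rule le[OF c(1)])
          also have "\<dots> \<le> c x + c y" by (rule sublinearD(1)[OF sub(1)[OF c(1)]])
          also have "\<dots> \<le> a x + b y" using c by (intro add_mono) (auto simp: le_fun_def)
          finally show ?thesis .
        qed
        have "r (x + y) - a x \<le> r y" if "a \<in> C" for a
          using * [OF that] by (intro ge) (simp add: algebra_simps)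
        then have "r (x + y) - r y \<le> r x" by (intro ge) (simp add: algebra_simps)
        then show "r (x + y) \<le> r x + r y" by simp
      next
        have "(\<lambda>q. q 0) ` C = {0}" using False sublinearD(3)[OF sub(1)] by force
        then show "r 0 = 0" by (simp add: r_def)
      next
        fix c :: real and x assume c: "0 < c"
        have "r (c *\<^sub>R x) \<le> c * q x" if "q \<in> C" for q
          using le[OF that, of "c *\<^sub>R x"] sublinearD(2)[OF sub(1)[OF that], of c x] c by simp
        then have "inverse c * r (c *\<^sub>R x) \<le> r x" using c by (intro ge) (simp add: field_simps)
        then show "r (c *\<^sub>R x) \<le> c * r x" using c by (simp add: field_simps)
      qed
      moreover have "r \<le> p"
        using False le sub(2) unfolding le_fun_def by (meson all_not_in_conv order_trans)
      ultimately show ?thesis using le by (intro bexI[of _ r]) (auto simp: A_def le_fun_def)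
    qed
  qed
  then obtain m where m: "m \<in> A" "\<And>a. a \<in> A \<Longrightarrow> a \<le> m \<Longrightarrow> a = m" by blast
  show ?thesis
  proof (rule that[of m])
    show "sublinear m" "m \<le> p" using m(1) by (auto simp: A_def)
    show "q = m" if "sublinear q" "q \<le> m" for q
      using m that by (auto simp: A_def)
  qed
qed

text \<open>First \<open>p\<close> is shrunk to \<open>r\<close> with
  \<open>r (- u) \<le> - p u\<close>, then a minimal \<open>m\<close> below \<open>r\<close> is
  taken. Minimality makes \<open>m\<close> odd, hence linear, and the bound at \<open>- u\<close>
  turns into \<open>p u \<le> m u\<close>.\<close>

lemma hahn_banach:
  fixes p :: "'a::real_vector \<Rightarrow> real"
  assumes p: "sublinear p"
  obtains f where "linear f" "\<And>x. f x \<le> p x" "f u = p u"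
proof -
  obtain r where r: "sublinear r" "\<And>x. r x \<le> p x" "r (- u) \<le> - p u"
    using sublinear_shrink[OF p] by blast
  obtain m where m: "sublinear m" "m \<le> r" "\<And>q. sublinear q \<Longrightarrow> q \<le> m \<Longrightarrow> q = m"
    using minimal_sublinear[OF r(1)] by blast
  have neg: "m (- x) = - m x" for x
  proof -
    obtain q where q: "sublinear q" "\<And>y. q y \<le> m y" "q (- x) \<le> - m x"
      using sublinear_shrink[OF m(1)] by blast
    have "q = m" using q by (intro m(3)) (auto simp: le_fun_def)
    then show ?thesis using q(3) sublinearD(4)[OF m(1), of x] by simp
  qed
  have mr: "m x \<le> r x" for x using m(2) by (simp add: le_fun_def)
  have mp: "m x \<le> p x" for x using mr[of x] r(2)[of x] by simp
  show ?thesis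
  proof (rule that[of m])
    show "linear m"
    proof (rule linearI)
      fix x y
      show "m (x + y) = m x + m y"
        using sublinearD(1)[OF m(1), of x y] sublinearD(1)[OF m(1), of "- x" "- y"]
          neg[of x] neg[of y] neg[of "x + y"] by simp
    next
      fix c x
      show "m (c *\<^sub>R x) = c *\<^sub>R m x"
        using sublinearD(2)[OF m(1), of c x] sublinearD(2)[OF m(1), of "- c" x] neg[of "c *\<^sub>R x"]
        by (cases "0 \<le> c") auto
    qed
    show "m x \<le> p x" for x by (rule mp)
    show "m u = p u" using mr[of "- u"] r(3) neg[of u] mp[of u] by simp
  qed
qed

lemma separating_functional:
  fixes x y :: "'a::real_normed_vector"
  assumes "x \<noteq> y"
  obtains f :: "'a \<Rightarrow> real" where "bounded_linear f" "f x \<noteq> f y"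
proof -
  have "sublinear (norm :: 'a \<Rightarrow> real)" by (simp add: sublinear_def norm_triangle_ineq)
  then obtain f where f: "linear f" "\<And>z. f z \<le> norm z" "f (x - y) = norm (x - y)"
    using hahn_banach[where u="x - y"] by blast
  have "\<bar>f z\<bar> \<le> norm z" for z
    using f(2)[of z] f(2)[of "- z"] linear_neg[OF f(1), of z] by simp
  then have "bounded_linear f"
    using f(1) by (auto simp: bounded_linear_def bounded_linear_axioms_def intro: exI[of _ 1])
  moreover have "f x \<noteq> f y" using f(3) linear_diff[OF f(1), of x y] assms by auto
  ultimately show ?thesis by (rule that)
qed

subsection \<open>Compactness\<close>

lemma Hausdorff_space_weak_topology:
  "Hausdorff_space (weak_topology :: 'a::real_normed_vector topology)"
  unfolding Hausdorff_space_def
proof (intro allI impI)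
  fix x y :: 'a assume "x \<in> topspace weak_topology \<and> y \<in> topspace weak_topology \<and> x \<noteq> y"
  then obtain f :: "'a \<Rightarrow> real" where f: "bounded_linear f" "f x \<noteq> f y"
    using separating_functional by blast
  obtain U V where UV: "open U" "open V" "f x \<in> U" "f y \<in> V" "U \<inter> V = {}"
    using hausdorff[OF f(2)] by blast
  have "openin weak_topology (f -` W)" if "open W" for W
    unfolding weak_topology_def using f(1) that by (intro topology_generated_by_Basis) blast
  then show "\<exists>U V. openin weak_topology U \<and> openin weak_topology V \<and> x \<in> U \<and> y \<in> V \<and> disjnt U V"
    using UV by (intro exI[of _ "f -` U"] exI[of _ "f -` V"]) (auto simp: disjnt_def)
qed

lemma compact_imp_compactin_weak:
  fixes K :: "'a::real_normed_vector set"
  assumes "compact K"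
  shows "compactin weak_topology K"
proof -
  have "continuous_map euclidean (weak_topology :: 'a topology) (\<lambda>x. x)"
    unfolding weak_topology_def
  proof (rule continuous_on_generated_topo)
    show "openin euclidean ((\<lambda>x. x) -` U \<inter> topspace euclidean)"
      if "U \<in> {f -` U |(f :: 'a \<Rightarrow> real) U. bounded_linear f \<and> open U}" for U
      using that linear_continuous_on by (auto intro!: open_vimage)
    \<comment> \<open>The zero functional puts the whole space into the generating family, so the
      generated topology lives on all of \<open>'a\<close>.\<close>
    have "(UNIV :: 'a set) \<in> {f -` U |(f :: 'a \<Rightarrow> real) U. bounded_linear f \<and> open U}"
      using bounded_linear_zero[where 'a='a and 'b=real] by (auto intro!: exI[of _ "\<lambda>_. 0"] exI[of _ UNIV])
    then show "(\<lambda>x. x) ` topspace euclidean \<subseteq> \<Union> {f -` U |(f :: 'a \<Rightarrow> real) U. bounded_linear f \<and> open U}"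
      by blast
  qed
  from image_compactin[OF _ this, of K] show ?thesis using assms by simp
qed

text \<open>The norm closure of the image is weakly compact, hence weakly closed by the Hausdorff
  property. It therefore contains the weak closure, a closed subset of a compact set.\<close>

lemma compact_operator_imp_weakly_compact:
  assumes "compact_operator T"
  shows "weakly_compact_operator T"
proof -
  let ?S = "T ` cball 0 1"
  have K: "compactin weak_topology (closure ?S)"
    using assms by (intro compact_imp_compactin_weak) (simp add: compact_operator_def)
  have "weak_topology closure_of ?S \<subseteq> closure ?S"
    by (intro closure_of_minimal compactin_imp_closedin K closure_subset Hausdorff_space_weak_topology)
  then have "compactin weak_topology (weak_topology closure_of ?S)"
    by (rule closed_compactin[OF K]) simp
  then show ?thesis using assms by (simp add: weakly_compact_operator_def compact_operator_def)
qed

text \<open>The cube is compact by Tychonoff, and by the Weierstrass test the series is a uniform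
  limit on it of continuous partial sums.\<close>

lemma compact_series_cube:
  fixes w :: "nat \<Rightarrow> 'a::banach"
  assumes "summable (\<lambda>k. norm (w k))"
  shows "compact ((\<lambda>a. \<Sum>k. a k *\<^sub>R w k) ` (UNIV \<rightarrow> {-1..1}))"
proof (rule compact_continuous_image)
  let ?A = "UNIV \<rightarrow> {-1..1} :: (nat \<Rightarrow> real) set"
  have "compactin (product_topology (\<lambda>_::nat. euclideanreal) UNIV) (Pi\<^sub>E UNIV (\<lambda>_. {-1..1}))"
    by (subst compactin_PiE) auto
  then show "compact ?A" by (simp add: euclidean_product_topology PiE_UNIV_domain Pi_def)
  show "continuous_on ?A (\<lambda>a. \<Sum>k. a k *\<^sub>R w k)"
  proof (rule uniform_limit_theorem)
    show "uniform_limit ?A (\<lambda>n a. \<Sum>k<n. a k *\<^sub>R w k) (\<lambda>a. \<Sum>k. a k *\<^sub>R w k) sequentially"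
    proof (rule Weierstrass_m_test[OF _ assms])
      fix n and a :: "nat \<Rightarrow> real" assume "a \<in> ?A"
      then have "\<bar>a n\<bar> \<le> 1" by (auto simp: Pi_def abs_le_iff minus_le_iff)
      then show "norm (a n *\<^sub>R w n) \<le> norm (w n)" by (simp add: mult_left_le_one_le)
    qed
    have "continuous_on ?A (\<lambda>a. a k)" for k by (intro continuous_on_product_coordinates continuous_on_subset[OF _ subset_UNIV])
    then show "\<forall>\<^sub>F n in sequentially. continuous_on ?A (\<lambda>a. \<Sum>k<n. a k *\<^sub>R w k)"
      by (intro always_eventually allI continuous_intros)
  qed simp
qed

subsection \<open>Banach lattices\<close>

lemma norm_abs [simp]: "norm \<bar>x::'a::banach_lattice\<bar> = norm x"
  by (intro antisym norm_le_of_abs_le) simp_all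

lemma norm_mono:
  fixes x y :: "'a::banach_lattice"
  assumes "0 \<le> x" "x \<le> y"
  shows "norm x \<le> norm y"
  using assms order_trans[OF assms] by (intro norm_le_of_abs_le) simp

lemma norm_pprt_le: "norm (pprt x) \<le> norm (x::'a::banach_lattice)"
proof -
  have "norm (pprt x) \<le> norm \<bar>x\<bar>"
    by (rule norm_mono) (simp_all add: pprt_def abs_ge_self)
  then show ?thesis by simp
qed

lemma pprt_add_le: "pprt (x + y) \<le> pprt x + pprt (y::'a::lattice_ab_group_add)"
  by (simp add: pprt_def add_mono)

text \<open>The positive part of \<open>- l\<close> is dominated by that of \<open>x n - l\<close>,
  whose norm tends to zero.\<close>

lemma nonneg_limit:
  fixes x :: "nat \<Rightarrow> 'a::banach_lattice"
  assumes "x \<longlonglongrightarrow> l" "\<And>n. 0 \<le> x n"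
  shows "0 \<le> l"
proof -
  have "norm (pprt (- l)) \<le> norm (x n - l)" for n
  proof -
    have "norm (pprt (- l)) \<le> norm (pprt (x n - l))"
      using assms(2)[of n] by (intro norm_mono pprt_mono) simp_all
    also have "\<dots> \<le> norm (x n - l)" by (rule norm_pprt_le)
    finally show ?thesis .
  qed
  moreover have "(\<lambda>n. norm (x n - l)) \<longlonglongrightarrow> 0"
    using assms(1) by (simp add: LIM_zero tendsto_norm_zero)
  ultimately have "norm (pprt (- l)) \<le> 0" by (intro LIMSEQ_le_const) auto
  then show ?thesis by (simp flip: le_zero_iff_zero_pprt)
qed

lemma limit_mono:
  fixes x y :: "nat \<Rightarrow> 'a::banach_lattice"
  assumes "x \<longlonglongrightarrow> l" "y \<longlonglongrightarrow> m" "\<And>n. x n \<le> y n"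
  shows "l \<le> m"
  using nonneg_limit[OF tendsto_diff[OF assms(2,1)]] assms(3) by simp

lemma suminf_nonneg_lattice:
  fixes a :: "nat \<Rightarrow> 'a::banach_lattice"
  assumes "summable a" "\<And>n. 0 \<le> a n"
  shows "a k \<le> suminf a" "0 \<le> suminf a"
proof -
  have *: "sum a {..<n} \<le> suminf a" for n
  proof (rule limit_mono)
    show "(\<lambda>m. sum a {..<n}) \<longlonglongrightarrow> sum a {..<n}" by simp
    show "(\<lambda>m. sum a {..<m + n}) \<longlonglongrightarrow> suminf a"
      using summable_LIMSEQ[OF assms(1)] by (rule LIMSEQ_ignore_initial_segment)
    show "sum a {..<n} \<le> sum a {..<m + n}" for m
      using assms(2) by (intro sum_mono2) auto
  qed
  show "0 \<le> suminf a" using *[of 0] by simp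
  have "a k \<le> sum a {..<Suc k}" using assms(2) by (simp add: sum_nonneg)
  then show "a k \<le> suminf a" using *[of "Suc k"] by (rule order_trans)
qed

text \<open>After division by \<open>n\<close>, \<open>z\<close> lies below multiples of
  \<open>b\<close> that tend to zero; the positive cone is closed.\<close>

lemma archimedean:
  fixes z b :: "'a::banach_lattice"
  assumes "\<And>n. real n *\<^sub>R z \<le> b"
  shows "z \<le> 0"
proof -
  have "0 \<le> inverse (real (Suc n)) *\<^sub>R b - z" for n
    using scaleR_left_mono[OF assms[of "Suc n"], of "inverse (real (Suc n))"] by simp
  moreover have "(\<lambda>n. inverse (real (Suc n)) *\<^sub>R b - z) \<longlonglongrightarrow> 0 *\<^sub>R b - z"
    by (intro tendsto_intros LIMSEQ_inverse_real_of_nat)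
  ultimately have "0 \<le> 0 *\<^sub>R b - z" by (rule nonneg_limit[rotated])
  then show ?thesis by simp
qed

text \<open>By distributivity the right side is the infimum of the four sums of one of
  \<open>a\<close>, \<open>c\<close> and one of \<open>b\<close>, \<open>c\<close>, and
  \<open>?m\<close> lies below each of them.\<close>

lemma inf_add_le:
  fixes a b c :: "'a::lattice_ab_group_add"
  assumes "0 \<le> a" "0 \<le> b" "0 \<le> c"
  shows "inf (a + b) c \<le> inf a c + inf b c"
proof -
  let ?m = "inf (a + b) c"
  have "?m \<le> inf b c + a"
    using assms(1) by (simp only: add_inf_distrib_right) (simp add: add.commute le_infI1 le_infI2 add_increasing2)
  moreover have "?m \<le> inf b c + c"
    using assms by (simp only: add_inf_distrib_right) (simp add: le_infI2 add_increasing)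
  ultimately have "?m \<le> inf b c + inf a c" by (simp only: add_inf_distrib_left le_inf_iff)
  then show ?thesis by (simp only: add.commute)
qed

lemma scaleR_inf:
  fixes x y :: "'a::banach_lattice"
  assumes "0 \<le> c"
  shows "c *\<^sub>R inf x y = inf (c *\<^sub>R x) (c *\<^sub>R y)"
proof (cases "c = 0")
  case False
  with assms have c: "0 < c" by simp
  show ?thesis
  proof (rule antisym)
    show "c *\<^sub>R inf x y \<le> inf (c *\<^sub>R x) (c *\<^sub>R y)"
      using assms by (auto intro: scaleR_left_mono)
    have "inverse c *\<^sub>R inf (c *\<^sub>R x) (c *\<^sub>R y) \<le> inverse c *\<^sub>R (c *\<^sub>R a)" if "a = x \<or> a = y" for a
      using that c by (intro scaleR_left_mono) auto
    then have "inverse c *\<^sub>R inf (c *\<^sub>R x) (c *\<^sub>R y) \<le> inf x y" using c by auto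
    then have "c *\<^sub>R (inverse c *\<^sub>R inf (c *\<^sub>R x) (c *\<^sub>R y)) \<le> c *\<^sub>R inf x y"
      using assms by (rule scaleR_left_mono)
    then show "inf (c *\<^sub>R x) (c *\<^sub>R y) \<le> c *\<^sub>R inf x y" using c by simp
  qed
qed simp

lemma pprt_scaleR:
  fixes x :: "'a::banach_lattice"
  assumes "0 \<le> c"
  shows "pprt (c *\<^sub>R x) = c *\<^sub>R pprt x"
  unfolding pprt_def sup_eq_neg_inf using scaleR_inf[OF assms, of "- x" 0]
  by (simp only: scaleR_minus_right minus_zero scaleR_zero_right)

lemma inf_scaleR_eq_0:
  fixes x y :: "'a::banach_lattice"
  assumes "inf x y = 0" "0 \<le> c"
  shows "inf x (c *\<^sub>R y) = 0"
proof -
  have xy: "0 \<le> x" "0 \<le> y" using assms(1) by (metis inf_le1, metis inf_le2)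
  \<comment> \<open>Enlarging both scalars to the common factor \<open>d\<close> allows it to be
    pulled out of the infimum.\<close>
  define d where "d = max 1 c"
  have "inf x (c *\<^sub>R y) \<le> inf (d *\<^sub>R x) (d *\<^sub>R y)"
    using scaleR_right_mono[of 1 d x] scaleR_right_mono[of c d y] xy
    by (intro inf_mono) (auto simp: d_def)
  also have "\<dots> = d *\<^sub>R inf x y" by (rule scaleR_inf[symmetric]) (simp add: d_def)
  finally have "inf x (c *\<^sub>R y) \<le> 0" using assms(1) by simp
  moreover have "0 \<le> inf x (c *\<^sub>R y)" using xy assms(2) by (simp add: scaleR_nonneg_nonneg)
  ultimately show ?thesis by (rule antisym)
qed

section \<open>Order continuity along order bounded increasing sequences\<close>

lemma order_bounded_incseq_convergent:
  fixes x :: "nat \<Rightarrow> 'a::banach_lattice"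
  assumes oc: "order_continuous_norm TYPE('a)" and x: "incseq x" and b: "\<And>n. x n \<le> b"
  shows "convergent x"
proof -
  \<comment> \<open>The net of all differences between upper bounds and terms of \<open>x\<close> decreases to zero.\<close>
  define U where "U = {u. \<forall>n. x n \<le> u}"
  define le where "le = (\<lambda>(u::'a, n::nat) (v, m). v \<le> u \<and> n \<le> m)"
  define y where "y = (\<lambda>(u, n). u - x n)"
  have dir: "directed_preorder (U \<times> UNIV) le"
    unfolding directed_preorder_def
  proof (intro conjI ballI)
    show "U \<times> UNIV \<noteq> ({} :: ('a \<times> nat) set)" using b by (auto simp: U_def)
    show "reflp_on (U \<times> UNIV) le" by (auto simp: reflp_on_def le_def)
    show "transp_on (U \<times> UNIV) le" by (auto simp: transp_on_def le_def)
    fix i j assume "i \<in> U \<times> (UNIV :: nat set)" "j \<in> U \<times> (UNIV :: nat set)"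
    then show "\<exists>k\<in>U \<times> UNIV. le i k \<and> le j k"
      by (intro bexI[of _ "(inf (fst i) (fst j), max (snd i) (snd j))"]) (auto simp: le_def U_def)
  qed
  have mono: "monotone_on (U \<times> UNIV) le (\<ge>) y"
    using x by (auto simp: monotone_on_def le_def y_def incseq_def intro!: diff_mono)
  have inf0: "(\<forall>i\<in>U \<times> UNIV. z \<le> y i) \<longleftrightarrow> z \<le> 0" for z
  proof
    assume "\<forall>i\<in>U \<times> UNIV. z \<le> y i"
    \<comment> \<open>A lower bound \<open>z\<close> of all differences can be subtracted from any
      upper bound of \<open>x\<close>. Iterating from \<open>b\<close> and comparing with
      \<open>x 0\<close> bounds all multiples of \<open>z\<close>, so the Archimedean property
      applies.\<close>
    then have step: "u - z \<in> U" if "u \<in> U" for u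
      using that by (auto simp: U_def y_def le_diff_eq add.commute)
    have "b - real n *\<^sub>R z \<in> U" for n
    proof (induction n)
      case (Suc n)
      then show ?case using step[OF Suc] by (simp add: algebra_simps)
    qed (use b in \<open>simp add: U_def\<close>)
    then have "real n *\<^sub>R z \<le> b - x 0" for n by (auto simp: U_def algebra_simps)
    then show "z \<le> 0" by (rule archimedean)
  next
    assume "z \<le> 0"
    moreover have "0 \<le> y i" if "i \<in> U \<times> UNIV" for i
      using that by (auto simp: U_def y_def)
    ultimately show "\<forall>i\<in>U \<times> UNIV. z \<le> y i" by (meson order_trans)
  qed
  have lim: "((\<lambda>i. norm (y i)) \<longlongrightarrow> 0) (tails (U \<times> UNIV) le)"
    using oc dir mono inf0 by (rule order_continuous_norm_net)
  have "Cauchy x"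
  proof (rule CauchyI')
    fix e :: real assume "0 < e"
    with lim have "\<forall>\<^sub>F i in tails (U \<times> UNIV) le. norm (y i) < e"
      by (rule order_tendstoD)
    then obtain u n where u: "u \<in> U" "norm (u - x n) < e"
      unfolding eventually_tails[OF dir] by (force simp: le_def y_def)
    have "dist (x m) (x p) < e" if "n \<le> m" "m < p" for m p
    proof -
      have "norm (x p - x m) \<le> norm (u - x n)"
        using that incseqD[OF x] u(1) by (intro norm_mono diff_mono) (auto simp: U_def)
      then show ?thesis using u(2) by (simp add: dist_norm norm_minus_commute)
    qed
    then show "\<exists>M. \<forall>m\<ge>M. \<forall>n>m. dist (x m) (x n) < e" by blast
  qed
  then show ?thesis by (rule Cauchy_convergent)
qed

subsection \<open>Functionals carried by a positive element\<close>

text \<open>A functional dominated by this sublinear functional is automatically positive, of norm at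
  most one, and zero on every positive element disjoint from \<open>u\<close>.\<close>
definition carrier_norm :: "'a::banach_lattice \<Rightarrow> 'a \<Rightarrow> real" where
  "carrier_norm u x = (SUP t\<in>{0..}. norm (inf (pprt x) (t *\<^sub>R u)))"

context
  fixes u :: "'a::banach_lattice"
  assumes u: "0 \<le> u"
begin

lemma norm_inf_carrier_le:
  assumes "0 \<le> t"
  shows "norm (inf (pprt x) (t *\<^sub>R u)) \<le> norm (pprt x)"
  using assms u by (intro norm_mono) (simp_all add: scaleR_nonneg_nonneg)

lemma carrier_norm_upper:
  assumes "0 \<le> t"
  shows "norm (inf (pprt x) (t *\<^sub>R u)) \<le> carrier_norm u x"
  unfolding carrier_norm_def using assms norm_inf_carrier_le
  by (intro cSUP_upper bdd_aboveI2) auto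

lemma carrier_norm_least:
  assumes "\<And>t. 0 \<le> t \<Longrightarrow> norm (inf (pprt x) (t *\<^sub>R u)) \<le> a"
  shows "carrier_norm u x \<le> a"
  unfolding carrier_norm_def using assms by (intro cSUP_least) auto

lemma carrier_norm_le: "carrier_norm u x \<le> norm (pprt x)"
  by (intro carrier_norm_least norm_inf_carrier_le)

lemma carrier_norm_eq_0:
  assumes "inf (pprt x) u = 0"
  shows "carrier_norm u x = 0"
  using assms by (simp add: carrier_norm_def inf_scaleR_eq_0)

lemma carrier_norm_self: "carrier_norm u u = norm u"
  using carrier_norm_le[of u] carrier_norm_upper[of 1 u] u by simp

text \<open>Subadditivity comes from \<open>inf_add_le\<close>; homogeneity from replacing
  \<open>t\<close> by \<open>t / c\<close> in the supremum.\<close>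

lemma sublinear_carrier_norm: "sublinear (carrier_norm u)"
proof (rule sublinearI)
  fix x y
  show "carrier_norm u (x + y) \<le> carrier_norm u x + carrier_norm u y"
  proof (rule carrier_norm_least)
    fix t :: real assume t: "0 \<le> t"
    then have tu: "0 \<le> t *\<^sub>R u" using u by (rule scaleR_nonneg_nonneg)
    have "inf (pprt (x + y)) (t *\<^sub>R u) \<le> inf (pprt x + pprt y) (t *\<^sub>R u)"
      by (intro inf_mono pprt_add_le order_refl)
    also have "\<dots> \<le> inf (pprt x) (t *\<^sub>R u) + inf (pprt y) (t *\<^sub>R u)"
      using tu by (intro inf_add_le) simp_all
    finally have "norm (inf (pprt (x + y)) (t *\<^sub>R u)) \<le> norm (inf (pprt x) (t *\<^sub>R u) + inf (pprt y) (t *\<^sub>R u))"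
      using tu by (intro norm_mono) simp_all
    also have "\<dots> \<le> carrier_norm u x + carrier_norm u y"
      by (intro norm_triangle_mono carrier_norm_upper t)
    finally show "norm (inf (pprt (x + y)) (t *\<^sub>R u)) \<le> carrier_norm u x + carrier_norm u y" .
  qed
next
  show "carrier_norm u 0 = 0" using u by (intro carrier_norm_eq_0) (simp add: inf.absorb1)
next
  fix c :: real and x assume c: "0 < c"
  show "carrier_norm u (c *\<^sub>R x) \<le> c * carrier_norm u x"
  proof (rule carrier_norm_least)
    fix t :: real assume t: "0 \<le> t"
    have "inf (pprt (c *\<^sub>R x)) (t *\<^sub>R u) = c *\<^sub>R inf (pprt x) ((t / c) *\<^sub>R u)"
      using c by (simp add: pprt_scaleR scaleR_inf)
    then show "norm (inf (pprt (c *\<^sub>R x)) (t *\<^sub>R u)) \<le> c * carrier_norm u x"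
      using c t carrier_norm_upper[of "t / c" x] by simp
  qed
qed

lemma carried_functional:
  obtains f :: "'a \<Rightarrow> real"
  where "linear f" "\<And>x. 0 \<le> x \<Longrightarrow> 0 \<le> f x" "\<And>x. \<bar>f x\<bar> \<le> norm x" "\<And>x. f x \<le> carrier_norm u x"
    "f u = norm u"
proof -
  obtain f where f: "linear f" "\<And>x. f x \<le> carrier_norm u x" "f u = carrier_norm u u"
    using hahn_banach[OF sublinear_carrier_norm] by blast
  have le: "f x \<le> norm (pprt x)" for x
    using f(2)[of x] carrier_norm_le[of x] by linarith
  have neg: "f (- x) = - f x" for x by (rule linear_neg[OF f(1)])
  show ?thesis
  proof
    \<comment> \<open>For \<open>0 \<le> x\<close> the positive part of \<open>- x\<close> vanishes,
      so \<open>f (- x) \<le> 0\<close>.\<close>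
    show "0 \<le> f x" if "0 \<le> x" for x using le[of "- x"] that by (simp add: neg)
    show "\<bar>f x\<bar> \<le> norm x" for x
      using le[of x] le[of "- x"] norm_pprt_le[of x] norm_pprt_le[of "- x"] by (simp add: neg)
  qed (use f carrier_norm_self in auto)
qed

end

text \<open>Disjoint positive elements have their supremum as sum. Partial sums stay disjoint from
  later terms, so each new term can be added as a supremum.\<close>

lemma sum_disjoint_le:
  fixes a :: "nat \<Rightarrow> 'a::lattice_ab_group_add"
  assumes "\<And>k. 0 \<le> a k" "\<And>j k. j \<noteq> k \<Longrightarrow> inf (a j) (a k) = 0" "\<And>k. a k \<le> y" "0 \<le> y"
  shows "sum a {..<n} \<le> y"
proof -
  have pos: "0 \<le> sum a {..<n}" for n by (simp add: assms(1) sum_nonneg)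
  have disj: "inf (sum a {..<n}) (a m) = 0" if "n \<le> m" for n m
    using that
  proof (induction n)
    case 0
    then show ?case by (simp add: assms(1) inf.absorb1)
  next
    case (Suc n)
    have "inf (sum a {..<Suc n}) (a m) \<le> inf (sum a {..<n}) (a m) + inf (a n) (a m)"
      using inf_add_le[OF pos assms(1) assms(1)] by simp
    also have "\<dots> = 0" using Suc assms(2) by simp
    finally have "inf (sum a {..<Suc n}) (a m) \<le> 0" .
    moreover have "0 \<le> inf (sum a {..<Suc n}) (a m)" using pos assms(1) by (simp del: sum.lessThan_Suc)
    ultimately show ?case by (rule antisym)
  qed
  show ?thesis
  proof (induction n)
    case (Suc n)
    have "sum a {..<Suc n} = sup (sum a {..<n}) (a n)"
      using disj[of n n] add_eq_inf_sup[of "sum a {..<n}" "a n"] by simp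
    then show ?case using Suc assms(3) by simp
  qed (simp add: assms)
qed

lemma inf_eq_0_mono:
  fixes a b c d :: "'a::lattice_ab_group_add"
  assumes "inf c d = 0" "0 \<le> a" "0 \<le> b" "a \<le> c" "b \<le> d"
  shows "inf a b = 0"
proof (rule antisym)
  show "inf a b \<le> 0" using inf_mono[OF assms(4,5)] assms(1) by simp
  show "0 \<le> inf a b" using assms(2,3) by simp
qed

text \<open>Choose \<open>t k\<close> nearly attaining the supremum. The truncations of
  \<open>y\<close> are disjoint and below \<open>y\<close>, so their partial sums increase and stay
  below \<open>y\<close>; order continuity makes the series converge, and its terms tend to
  zero.\<close>

lemma carrier_norm_tendsto_0:
  fixes u :: "nat \<Rightarrow> 'a::banach_lattice"
  assumes oc: "order_continuous_norm TYPE('a)"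
    and u: "\<And>k. 0 \<le> u k" "\<And>j k. j \<noteq> k \<Longrightarrow> inf (u j) (u k) = 0" and y: "0 \<le> y"
  shows "(\<lambda>k. carrier_norm (u k) y) \<longlonglongrightarrow> 0"
proof -
  have "\<exists>t\<ge>0. carrier_norm (u k) y - inverse (real (Suc k)) \<le> norm (inf y (t *\<^sub>R u k))" for k
  proof (rule ccontr)
    assume *: "\<not> ?thesis"
    then have "carrier_norm (u k) y \<le> carrier_norm (u k) y - inverse (real (Suc k))"
      using y by (intro carrier_norm_least[OF u(1)]) force
    then show False by simp
  qed
  then obtain t where t: "\<And>k. 0 \<le> t k"
      "\<And>k. carrier_norm (u k) y - inverse (real (Suc k)) \<le> norm (inf y (t k *\<^sub>R u k))"
    by metis
  define a where "a k = inf y (t k *\<^sub>R u k)" for k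
  have a: "0 \<le> a k" "a k \<le> y" for k
    using y t(1) u(1) by (auto simp: a_def scaleR_nonneg_nonneg)
  have "inf (t j *\<^sub>R u j) (t k *\<^sub>R u k) = 0" if "j \<noteq> k" for j k
    using u(2)[OF that] t(1) by (metis inf.commute inf_scaleR_eq_0)
  then have disj: "inf (a j) (a k) = 0" if "j \<noteq> k" for j k
    using that by (intro inf_eq_0_mono[OF _ a(1) a(1)]) (auto simp: a_def)
  have "convergent (\<lambda>n. sum a {..<n})"
  proof (rule order_bounded_incseq_convergent[OF oc])
    show "incseq (\<lambda>n. sum a {..<n})" by (auto intro!: incseq_SucI a)
    show "sum a {..<n} \<le> y" for n by (rule sum_disjoint_le[OF a(1) disj a(2) y])
  qed
  then have "summable a" by (simp add: summable_iff_convergent)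
  then have "a \<longlonglongrightarrow> 0" by (rule summable_LIMSEQ_zero)
  then have "(\<lambda>k. norm (a k)) \<longlonglongrightarrow> 0" by (rule tendsto_norm_zero)
  then have lim: "(\<lambda>k. norm (a k) + inverse (real (Suc k))) \<longlonglongrightarrow> 0"
    using tendsto_add[OF _ LIMSEQ_inverse_real_of_nat] by fastforce
  show ?thesis
  proof (rule tendsto_sandwich[OF _ _ tendsto_const lim])
    show "\<forall>\<^sub>F k in sequentially. 0 \<le> carrier_norm (u k) y"
      using order_trans[OF norm_ge_zero carrier_norm_upper[OF u(1), of 0 y]] by simp
    show "\<forall>\<^sub>F k in sequentially. carrier_norm (u k) y \<le> norm (a k) + inverse (real (Suc k))"
      using t(2) by (simp add: a_def algebra_simps)
  qed
qed

subsection \<open>Nets in KB-spaces\<close>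

text \<open>Without the Cauchy property one could pick an increasing bounded sequence with jumps at
  least \<open>e\<close>. With it, a chain of indices with shrinking tail oscillation is chosen, and
  its limit attracts the whole net.\<close>

lemma KB_space_net_converges:
  fixes x :: "'i \<Rightarrow> 'a::banach_lattice"
  assumes KB: "KB_space TYPE('a)" and dir: "directed_preorder I le"
    and mono: "monotone_on I le (\<le>) x" and im: "x ` I \<subseteq> cball 0 1 \<inter> {0..}"
  shows "\<exists>z. (x \<longlongrightarrow> z) (tails I le)"
proof -
  have seq: "convergent (\<lambda>n. x (i n))" if i: "\<And>n. i n \<in> I" "\<And>n. le (i n) (i (Suc n))" for i :: "nat \<Rightarrow> 'i"
  proof -
    have "bounded (range (\<lambda>n. x (i n)))"
      using im i(1) by (intro bounded_subset[OF bounded_cball[of 0 1]]) auto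
    moreover have "0 \<le> x (i n)" for n using im i(1)[of n] by auto
    moreover have "incseq (\<lambda>n. x (i n))"
      using i by (intro incseq_SucI monotone_onD[OF mono]) auto
    ultimately show ?thesis using KB unfolding KB_space_def by blast
  qed
  have cauchy: "\<exists>i\<in>I. \<forall>j\<in>I. le i j \<longrightarrow> norm (x j - x i) < e" if e: "0 < e" for e
  proof (rule ccontr)
    assume "\<not> ?thesis"
    then have *: "\<exists>j. j \<in> I \<and> le i j \<and> e \<le> norm (x j - x i)" if "i \<in> I" for i
      using that by (meson not_less)
    have "\<exists>i. \<forall>n. i n \<in> I \<and> (le (i n) (i (Suc n)) \<and> e \<le> norm (x (i (Suc n)) - x (i n)))"
    proof (rule dependent_nat_choice)
      show "\<exists>i. i \<in> I" using dir by (auto simp: directed_preorder_def)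
      show "\<exists>j. j \<in> I \<and> (le i j \<and> e \<le> norm (x j - x i))" if "i \<in> I" for i
        using *[OF that] by simp
    qed
    then obtain i where i: "\<And>n. i n \<in> I" "\<And>n. le (i n) (i (Suc n))"
        "\<And>n. e \<le> norm (x (i (Suc n)) - x (i n))" by blast
    have "Cauchy (\<lambda>n. x (i n))" using seq i by (simp add: convergent_Cauchy)
    then obtain N where "\<And>m n. m \<ge> N \<Longrightarrow> n \<ge> N \<Longrightarrow> norm (x (i m) - x (i n)) < e"
      using e unfolding Cauchy_iff by blast
    from this[of "Suc N" N] i(3)[of N] show False by simp
  qed
  have dirD: "\<exists>k\<in>I. le i k \<and> le j k" if "i \<in> I" "j \<in> I" for i j
    using dir that by (simp add: directed_preorder_def)
  have transD: "le i k" if "le i j" "le j k" "i \<in> I" "j \<in> I" "k \<in> I" for i j k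
    using dir that transp_onD[of I le i j k] by (simp add: directed_preorder_def)
  \<comment> \<open>A common successor of \<open>i\<close> and an index with tail oscillation below
    \<open>e / 2\<close> lies above \<open>i\<close> and has tail oscillation below
    \<open>e\<close>.\<close>
  have up: "\<exists>k. (k \<in> I \<and> (\<forall>j\<in>I. le k j \<longrightarrow> norm (x j - x k) < e)) \<and> le i k"
    if i: "i \<in> I" and e: "0 < e" for i e
  proof -
    obtain h where h: "h \<in> I" "\<And>j. j \<in> I \<Longrightarrow> le h j \<Longrightarrow> norm (x j - x h) < e / 2"
      using cauchy[OF half_gt_zero[OF e]] by blast
    obtain k where k: "k \<in> I" "le i k" "le h k"
      using dirD[OF i h(1)] by blast
    have "norm (x j - x k) < e" if "j \<in> I" "le k j" for j
    proof -
      have "le h j" using k(3) that(2) h(1) k(1) that(1) by (rule transD)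
      then have "norm ((x j - x h) - (x k - x h)) < e"
        using h(2)[OF that(1)] h(2)[OF k(1,3)] norm_triangle_ineq4[of "x j - x h" "x k - x h"] by linarith
      then show ?thesis by simp
    qed
    then show ?thesis using k by blast
  qed
  obtain i where i: "\<And>n. i n \<in> I \<and> (\<forall>j\<in>I. le (i n) j \<longrightarrow> norm (x j - x (i n)) < inverse (real (Suc n)))"
      "\<And>n. le (i n) (i (Suc n))"
  proof -
    let ?P = "\<lambda>n k. k \<in> I \<and> (\<forall>j\<in>I. le k j \<longrightarrow> norm (x j - x k) < inverse (real (Suc n)))"
    have "\<exists>f. \<forall>n. ?P n (f n) \<and> le (f n) (f (Suc n))"
    proof (rule dependent_nat_choice)
      show "\<exists>k. ?P 0 k" using cauchy[of "inverse (real (Suc 0))"] by auto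
      show "\<exists>l. ?P (Suc n) l \<and> le k l" if "?P n k" for n k
        using that by (intro up) auto
    qed
    then show ?thesis using that by blast
  qed
  obtain z where z: "(\<lambda>n. x (i n)) \<longlonglongrightarrow> z"
    using seq[of i] i unfolding convergent_def by blast
  have "(x \<longlongrightarrow> z) (tails I le)"
  proof (rule tendstoI)
    fix e :: real assume e: "0 < e"
    have "\<forall>\<^sub>F n in sequentially. dist (x (i n)) z < e / 2 \<and> inverse (real (Suc n)) < e / 2"
      using e by (intro eventually_conj tendstoD[OF z] order_tendstoD(2)[OF LIMSEQ_inverse_real_of_nat]) auto
    then obtain n where n: "dist (x (i n)) z < e / 2" "inverse (real (Suc n)) < e / 2"
      by (auto simp: eventually_sequentially)
    have "dist (x j) z < e" if "j \<in> I" "le (i n) j" for j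
    proof -
      have "dist (x j) (x (i n)) < inverse (real (Suc n))" using i(1) that by (simp add: dist_norm)
      with n show ?thesis using dist_triangle[of "x j" z "x (i n)"] by linarith
    qed
    then show "\<forall>\<^sub>F j in tails I le. dist (x j) z < e"
      unfolding eventually_tails[OF dir] using i(1) by (intro bexI[of _ "i n"]) simp_all
  qed
  then show ?thesis by blast
qed

lemma KB_space_imp_KB_operator:
  fixes T :: "'a::banach_lattice \<Rightarrow> 'b::banach"
  assumes "KB_space TYPE('a)" "bounded_linear T"
  shows "KB_operator T"
  unfolding KB_operator_def
proof (intro conjI allI impI assms(2))
  fix I :: "'a set" and le and x :: "'a \<Rightarrow> 'a"
  assume "directed_preorder I le \<and> monotone_on I le (\<le>) x \<and> x ` I \<subseteq> cball 0 1 \<inter> {0..}"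
  then obtain z where "(x \<longlongrightarrow> z) (tails I le)"
    using KB_space_net_converges[OF assms(1)] by blast
  then have "((\<lambda>i. T (x i)) \<longlongrightarrow> T z) (tails I le)"
    by (rule bounded_linear.tendsto[OF assms(2)])
  then show "\<exists>z. ((\<lambda>i. norm (T (x i) - T z)) \<longlongrightarrow> 0) (tails I le)"
    by (intro exI[of _ z] tendsto_norm_zero LIM_zero)
qed

subsection \<open>Disjoint sequences below a divergent increasing sequence\<close>

lemma pprt_diff_eq: "pprt (a - b) = a - inf a (b::'a::lattice_ab_group_add)"
  unfolding pprt_def diff_inf_eq_sup add_sup_distrib_left
  by (simp only: add.right_inverse diff_conv_add_uminus sup.commute)

text \<open>Writing \<open>d\<close> as \<open>pprt d - pprt (- d)\<close> and applying
  \<open>pprt_diff_eq\<close> to this difference leaves no room for a nonzero infimum.\<close>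

lemma inf_pprt_uminus: "inf (pprt d) (pprt (- d)) = (0::'a::lattice_ab_group_add)"
proof -
  have "pprt d + nprt d = d" by (rule prts[symmetric])
  then have "pprt d - pprt (- d) = d" by (simp add: pprt_neg)
  then have "pprt d = pprt d - inf (pprt d) (pprt (- d))"
    using pprt_diff_eq[of "pprt d" "pprt (- d)"] by simp
  then show ?thesis by (simp only: eq_diff_eq add_cancel_left_right)
qed

lemma norm_pprt_diff_ge:
  fixes a b :: "'a::banach_lattice"
  assumes "0 \<le> b"
  shows "norm (pprt a) - norm b \<le> norm (pprt (a - b))"
proof -
  have "pprt a \<le> pprt (a - b) + b"
    using pprt_add_le[of "a - b" b] assms by simp
  then have "norm (pprt a) \<le> norm (pprt (a - b) + b)" by (intro norm_mono) simp_all
  also have "\<dots> \<le> norm (pprt (a - b)) + norm b" by (rule norm_triangle_ineq)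
  finally show ?thesis by simp
qed

text \<open>For \<open>v = c *\<^sub>R x n\<close> the truncations \<open>inf (x m) v\<close> are
  order bounded, hence Cauchy. The persistent oscillation of \<open>x\<close> must then come from
  \<open>pprt (x m - v)\<close>, with a bound \<open>d\<close> that does not depend on
  \<open>n\<close> and \<open>c\<close>.\<close>

lemma divergent_incseq_gap:
  fixes x :: "nat \<Rightarrow> 'a::banach_lattice"
  assumes oc: "order_continuous_norm TYPE('a)" and x: "incseq x" and div: "\<not> convergent x"
  obtains d where "0 < d" "\<And>n c. \<exists>m\<ge>n. d \<le> norm (pprt (x m - c *\<^sub>R x n))"
proof -
  have "\<not> Cauchy x" using div Cauchy_convergent by blast
  then obtain e where e: "0 < e" "\<And>N. \<exists>m\<ge>N. \<exists>p\<ge>N. e \<le> norm (x m - x p)"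
    by (auto simp: Cauchy_iff not_less)
  have gap: "\<exists>m\<ge>n. e / 2 \<le> norm (pprt (x m - c *\<^sub>R x n))" for n c
  proof -
    define v where "v = c *\<^sub>R x n"
    have "convergent (\<lambda>m. inf (x m) v)"
    proof (rule order_bounded_incseq_convergent[OF oc])
      show "incseq (\<lambda>m. inf (x m) v)"
        by (intro incseq_SucI inf_mono order_refl incseq_SucD[OF x])
      show "inf (x m) v \<le> v" for m by simp
    qed
    then have "Cauchy (\<lambda>m. inf (x m) v)" by (rule convergent_Cauchy)
    then obtain N where N: "norm (inf (x m) v - inf (x p) v) < e / 2" if "m \<ge> N" "p \<ge> N" for m p
      unfolding Cauchy_iff using half_gt_zero[OF e(1)] by blast
    obtain i j where ij: "i \<ge> max N n" "j \<ge> max N n" "e \<le> norm (x i - x j)"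
      using e(2) by blast
    define m p where "m = max i j" and "p = min i j"
    have mp: "p \<ge> max N n" "p \<le> m" "e \<le> norm (x m - x p)"
      using ij by (auto simp: m_def p_def max_def min_def norm_minus_commute)
    have "(x m - x p) - (inf (x m) v - inf (x p) v) = pprt (x m - v) - pprt (x p - v)"
      by (simp add: pprt_diff_eq)
    \<comment> \<open>Since \<open>x p \<le> x m\<close>, this difference lies between zero and its
      first term.\<close>
    moreover have "norm (pprt (x m - v) - pprt (x p - v)) \<le> norm (pprt (x m - v))"
      using incseqD[OF x mp(2)] by (intro norm_mono) (simp_all add: diff_right_mono)
    moreover have "norm (x m - x p) - norm (inf (x m) v - inf (x p) v)
        \<le> norm ((x m - x p) - (inf (x m) v - inf (x p) v))"
      by (rule norm_triangle_ineq2)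
    ultimately have "e / 2 \<le> norm (pprt (x m - v))" using N[of m p] mp by simp
    then show ?thesis using mp(1,2) unfolding v_def by (intro exI[of _ m]) simp
  qed
  show ?thesis by (rule that[OF half_gt_zero[OF e(1)] gap])
qed

lemma divergent_incseq_disjoint:
  fixes x :: "nat \<Rightarrow> 'a::banach_lattice"
  assumes oc: "order_continuous_norm TYPE('a)" and x: "incseq x" "\<And>n. 0 \<le> x n" "\<And>n. norm (x n) \<le> M"
    and div: "\<not> convergent x"
  obtains z w d where "incseq z" "\<And>k. 0 \<le> z k" "\<And>k. norm (z k) \<le> M"
    "\<And>k. 0 \<le> w k" "\<And>k. w k \<le> z (Suc k)" "\<And>j k. j \<noteq> k \<Longrightarrow> inf (w j) (w k) = 0"
    "0 < d" "\<And>k. d \<le> norm (w k :: 'a)"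
proof -
  obtain d where d: "0 < d" "\<And>n c. \<exists>m\<ge>n. d \<le> norm (pprt (x m - c *\<^sub>R x n))"
    using divergent_incseq_gap[OF oc x(1) div] by blast
  have "\<exists>s. \<forall>k. True \<and> (s k \<le> s (Suc k) \<and> d \<le> norm (pprt (x (s (Suc k)) - 4 ^ k *\<^sub>R x (s k))))"
    by (rule dependent_nat_choice) (use d(2) in auto)
  then obtain s where s: "\<And>k. s k \<le> s (Suc k)"
      "\<And>k. d \<le> norm (pprt (x (s (Suc k)) - 4 ^ k *\<^sub>R x (s k)))" by blast
  define z where "z k = x (s k)" for k
  have z: "incseq z" "0 \<le> z k" "norm (z k) \<le> M" for k
    using s(1) incseqD[OF x(1)] x(2,3) by (auto simp: z_def intro: incseq_SucI)
  \<comment> \<open>The sum of the \<open>a k\<close> is a common majorant: \<open>z k\<close> is at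
    most \<open>2 ^ k\<close> times it.\<close>
  define a where "a k = (1/2) ^ k *\<^sub>R z k" for k
  have "summable a"
  proof (rule summable_comparison_test')
    show "summable (\<lambda>k. (1/2) ^ k * M)" by (intro summable_mult2 summable_geometric) simp
    show "norm (a k) \<le> (1/2) ^ k * M" if "0 \<le> k" for k
      using z(3)[of k] by (simp add: a_def mult_left_mono)
  qed
  moreover have "0 \<le> a k" for k by (simp add: a_def z scaleR_nonneg_nonneg)
  ultimately have y: "a k \<le> suminf a" "0 \<le> suminf a" for k
    by (rule suminf_nonneg_lattice)+
  \<comment> \<open>The large multiple of \<open>z k\<close> separates \<open>w k\<close> from
    earlier terms; the small multiple of the majorant separates it from later ones.\<close>
  define w where "w k = pprt (z (Suc k) - 4 ^ k *\<^sub>R z k - (1/2) ^ k *\<^sub>R suminf a)" for k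
  have w0: "0 \<le> w k" for k by (simp add: w_def)
  have wz: "w k \<le> z (Suc k)" for k
  proof -
    have "z (Suc k) - 4 ^ k *\<^sub>R z k - (1/2) ^ k *\<^sub>R suminf a \<le> z (Suc k) - 0 - 0"
      using z(2)[of k] y(2) by (intro diff_mono scaleR_nonneg_nonneg) simp_all
    then have "w k \<le> pprt (z (Suc k))" unfolding w_def by (intro pprt_mono) simp
    then show ?thesis using z(2) by simp
  qed
  have disj_less: "inf (w m) (w n) = 0" if "n < m" for m n
  proof -
    \<comment> \<open>Both elements are compared with this one \<open>e\<close>: \<open>w m\<close>
      lies below its positive part and \<open>w n\<close> below \<open>c\<close> times its negative
      part, and these parts are disjoint.\<close>
    define e where "e = z (Suc m) - 4 ^ m *\<^sub>R z (Suc n)"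
    \<comment> \<open>The factor \<open>(1/2) ^ Suc m\<close> turns \<open>z (Suc m)\<close> into
      \<open>a (Suc m)\<close>, and \<open>(1/2) ^ n\<close> is the weight of the majorant in
      \<open>w n\<close>.\<close>
    define c :: real where "c = (1/2) ^ n * (1/2) ^ Suc m"
    have c: "0 \<le> c" by (simp add: c_def)
    have "4 ^ m *\<^sub>R z (Suc n) \<le> 4 ^ m *\<^sub>R z m" using incseqD[OF z(1), of "Suc n" m] that
      by (intro scaleR_left_mono) auto
    then have "z (Suc m) - 4 ^ m *\<^sub>R z m - (1/2) ^ m *\<^sub>R suminf a \<le> e - 0"
      unfolding e_def using y(2) by (intro diff_mono scaleR_nonneg_nonneg) simp_all
    then have wm: "w m \<le> pprt e" unfolding w_def by (intro pprt_mono) simp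
    have "c *\<^sub>R z (Suc m) \<le> (1/2) ^ n *\<^sub>R suminf a"
      using scaleR_left_mono[OF y(1)[of "Suc m"], of "(1/2) ^ n"] by (simp add: a_def c_def)
    moreover have "z (Suc n) \<le> (c * 4 ^ m) *\<^sub>R z (Suc n)"
    proof -
      \<comment> \<open>Here \<open>n < m\<close> enters as \<open>n + Suc m \<le> 2 * m\<close>;
        this is why the factor \<open>4 ^ k\<close> was chosen.\<close>
      have "(2::real) ^ (n + Suc m) \<le> 2 ^ (2 * m)" using that by (intro power_increasing) auto
      also have "\<dots> = 4 ^ m" by (simp add: power_mult)
      finally have "1 \<le> c * 4 ^ m"
        by (simp add: c_def power_add power_one_over field_simps)
      from scaleR_right_mono[OF this z(2)[of "Suc n"]] show ?thesis by simp
    qed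
    moreover have "0 \<le> 4 ^ n *\<^sub>R z n" by (intro scaleR_nonneg_nonneg z) simp
    ultimately have "z (Suc n) - 4 ^ n *\<^sub>R z n - (1/2) ^ n *\<^sub>R suminf a
        \<le> (c * 4 ^ m) *\<^sub>R z (Suc n) - 0 - c *\<^sub>R z (Suc m)"
      by (intro diff_mono)
    also have "\<dots> = c *\<^sub>R (- e)" by (simp add: e_def algebra_simps)
    finally have wn: "w n \<le> c *\<^sub>R pprt (- e)"
      unfolding w_def pprt_scaleR[OF c, symmetric] by (rule pprt_mono)
    show ?thesis
      by (rule inf_eq_0_mono[OF inf_scaleR_eq_0[OF inf_pprt_uminus c] w0 w0 wm wn])
  qed
  have disj: "inf (w j) (w k) = 0" if "j \<noteq> k" for j k
    using that disj_less[of j k] disj_less[of k j] by (cases "j < k") (simp_all add: inf.commute)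
  have "(\<lambda>k. (1/2) ^ k * norm (suminf a)) \<longlonglongrightarrow> 0 * norm (suminf a)"
    by (intro tendsto_mult LIMSEQ_power_zero tendsto_const) simp
  then have "\<forall>\<^sub>F k in sequentially. (1/2) ^ k * norm (suminf a) < d / 2"
    using d(1) by (intro order_tendstoD) auto
  \<comment> \<open>From \<open>K\<close> on, subtracting the majorant costs less than
    \<open>d / 2\<close>, so shifting by \<open>K\<close> keeps the norms at least
    \<open>d / 2\<close>.\<close>
  then obtain K where K: "\<And>k. k \<ge> K \<Longrightarrow> (1/2) ^ k * norm (suminf a) < d / 2"
    by (auto simp: eventually_sequentially)
  have big: "d / 2 \<le> norm (w k)" if "k \<ge> K" for k
  proof -
    have "norm (pprt (z (Suc k) - 4 ^ k *\<^sub>R z k)) - norm ((1/2) ^ k *\<^sub>R suminf a) \<le> norm (w k)"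
      unfolding w_def using y(2) by (intro norm_pprt_diff_ge scaleR_nonneg_nonneg) simp_all
    then show ?thesis using K[OF that] s(2)[of k] by (simp add: z_def)
  qed
  show ?thesis
  proof (rule that[of "\<lambda>k. z (k + K)" "\<lambda>k. w (k + K)" "d / 2"])
    show "incseq (\<lambda>k. z (k + K))" using z(1) by (simp add: incseq_def)
  qed (use z wz w0 disj d(1) big in auto)
qed

subsection \<open>A compact positive operator that is not KB\<close>

lemma not_KB_space_imp_compact_not_KB:
  assumes oc: "order_continuous_norm TYPE('a::banach_lattice)"
    and nKB: "\<not> KB_space TYPE('a::banach_lattice)"
  obtains T :: "'a::banach_lattice \<Rightarrow> 'a" where "positive_operator T" "compact_operator T" "\<not> KB_operator T"
proof -
  obtain x :: "nat \<Rightarrow> 'a" where x: "incseq x" "\<And>n. 0 \<le> x n" "bounded (range x)" "\<not> convergent x"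
    using nKB unfolding KB_space_def by blast
  obtain M where M: "0 < M" "\<And>n. norm (x n) \<le> M"
    using x(3) by (auto simp: bounded_pos)
  obtain z w d where z: "incseq z" "\<And>k. 0 \<le> z k" "\<And>k. norm (z k) \<le> M"
    and w: "\<And>k. 0 \<le> w k" "\<And>k. w k \<le> z (Suc k)" "\<And>j k. j \<noteq> k \<Longrightarrow> inf (w j) (w k) = 0"
    and d: "0 < d" "\<And>k. d \<le> norm (w k :: 'a)"
    using divergent_incseq_disjoint[OF oc x(1,2) M(2) x(4)] by blast
  have "\<exists>f :: 'a \<Rightarrow> real. linear f \<and> (\<forall>x. 0 \<le> x \<longrightarrow> 0 \<le> f x) \<and> (\<forall>x. \<bar>f x\<bar> \<le> norm x)
      \<and> (\<forall>x. f x \<le> carrier_norm (w k) x) \<and> f (w k) = norm (w k)" for k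
    using carried_functional[OF w(1)[of k]] by metis
  then obtain f :: "nat \<Rightarrow> 'a \<Rightarrow> real" where f: "\<And>k. linear (f k)" "\<And>k x. 0 \<le> x \<Longrightarrow> 0 \<le> f k x"
      "\<And>k x. \<bar>f k x\<bar> \<le> norm x" "\<And>k x. f k x \<le> carrier_norm (w k) x" "\<And>k. f k (w k) = norm (w k)"
    by metis
  have bl: "bounded_linear (f k)" for k
    using f(1,3) by (auto simp: bounded_linear_def bounded_linear_axioms_def intro: exI[of _ 1])
  \<comment> \<open>Together with \<open>f k (w k) = norm (w k)\<close> this makes the system
    biorthogonal up to scaling, so coefficients can be read off from \<open>T x\<close>.\<close>
  have f0: "f j (w k) = 0" if "j \<noteq> k" for j k
  proof -
    have "carrier_norm (w j) (w k) = 0"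
      using w(3)[of k j] w(1) that by (intro carrier_norm_eq_0) auto
    then show ?thesis using f(4)[of j "w k"] f(2)[OF w(1), of j k] by simp
  qed
  define v where "v k = (1/2) ^ k *\<^sub>R w k" for k
  have sv: "summable (\<lambda>k. norm (v k))"
  proof (rule summable_comparison_test')
    show "summable (\<lambda>k. (1/2) ^ k * M)" by (intro summable_mult2 summable_geometric) simp
    show "norm (norm (v k)) \<le> (1/2) ^ k * M" if "0 \<le> k" for k
      using norm_mono[OF w(1,2)[of k]] z(3)[of "Suc k"] by (simp add: v_def mult_left_mono)
  qed
  define T where "T x = (\<Sum>k. f k x *\<^sub>R v k)" for x
  have bd: "norm (f k x *\<^sub>R v k) \<le> norm x * norm (v k)" for k x
    using f(3) by (simp add: mult_right_mono)
  have sb: "summable (\<lambda>k. norm x * norm (v k))" for x :: 'a using sv by (rule summable_mult)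
  have sn: "summable (\<lambda>k. norm (f k x *\<^sub>R v k))" for x
    using bd by (intro summable_comparison_test'[OF sb[of x]]) auto
  have sT: "summable (\<lambda>k. f k x *\<^sub>R v k)" for x using sn by (rule summable_norm_cancel)
  have blT: "bounded_linear T"
  proof (rule bounded_linear_intro)
    show "T (x + y) = T x + T y" for x y
      unfolding T_def using suminf_add[OF sT sT] by (simp add: linear_add[OF f(1)] scaleR_add_left)
    show "T (c *\<^sub>R x) = c *\<^sub>R T x" for c x
      unfolding T_def using bounded_linear.suminf[OF bounded_linear_scaleR_right sT]
      by (simp add: linear_scale[OF f(1)])
    show "norm (T x) \<le> norm x * (\<Sum>k. norm (v k))" for x
      unfolding T_def
      using summable_norm[OF sn[of x]] suminf_le[OF bd sn sb, of x] suminf_mult[OF sv, of "norm x"] by simp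
  qed
  have "positive_operator T"
    unfolding positive_operator_def
  proof (intro conjI allI impI blT)
    fix x :: 'a assume "0 \<le> x"
    then have "0 \<le> f k x *\<^sub>R v k" for k
      using f(2) w(1) by (simp add: v_def scaleR_nonneg_nonneg)
    then show "0 \<le> T x" unfolding T_def by (rule suminf_nonneg_lattice(2)[OF sT])
  qed
  moreover have "compact_operator T"
  proof -
    \<comment> \<open>On the unit ball all coefficients \<open>f k x\<close> lie in
      \<open>{-1..1}\<close>, so the image sits inside a compact set.\<close>
    let ?K = "(\<lambda>a. \<Sum>k. a k *\<^sub>R v k) ` (UNIV \<rightarrow> {-1..1})"
    have K: "compact ?K" by (rule compact_series_cube[OF sv])
    have "T ` cball 0 1 \<subseteq> ?K"
    proof
      fix y assume "y \<in> T ` cball 0 1"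
      then obtain x where x: "norm x \<le> 1" "y = T x" by auto
      have "\<bar>f k x\<bar> \<le> 1" for k using f(3)[of k x] x(1) by simp
      then have "(\<lambda>k. f k x) \<in> UNIV \<rightarrow> {-1..1}" by (auto simp: abs_le_iff minus_le_iff)
      then show "y \<in> ?K" unfolding x(2) T_def by (rule rev_image_eqI) simp
    qed
    then have "closure (T ` cball 0 1) \<subseteq> ?K" by (rule closure_minimal[OF _ compact_imp_closed[OF K]])
    then have "compact (closure (T ` cball 0 1))"
      using compact_Int_closed[OF K, of "closure (T ` cball 0 1)"] by (simp add: inf.absorb2)
    then show ?thesis using blT by (simp add: compact_operator_def)
  qed
  moreover have "\<not> KB_operator T"
  proof
    assume "KB_operator T"
    have dir: "directed_preorder (UNIV :: nat set) (\<le>)"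
      unfolding directed_preorder_def
      by (auto simp: reflp_on_def transp_on_def) (meson max.cobounded1 max.cobounded2)
    have tails: "tails (UNIV :: nat set) (\<le>) = sequentially"
      by (rule filter_eqI) (simp add: eventually_tails[OF dir] eventually_sequentially)
    define y where "y n = inverse M *\<^sub>R z n" for n
    have mono: "monotone_on UNIV (\<le>) (\<le>) y"
      using M(1) incseqD[OF z(1)] by (auto simp: monotone_on_def y_def intro: scaleR_left_mono)
    have im: "y ` UNIV \<subseteq> cball 0 1 \<inter> {0..}"
      using M(1) z(2,3) by (auto simp: y_def scaleR_nonneg_nonneg field_simps)
    obtain p where "((\<lambda>n. norm (T (y n) - T p)) \<longlongrightarrow> 0) (tails UNIV (\<le>))"
      using KB_operator_net[OF \<open>KB_operator T\<close> dir mono im] by blast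
    then have "(\<lambda>n. norm (T (y n) - T p)) \<longlonglongrightarrow> 0" by (simp only: tails)
    then have lim: "(\<lambda>n. T (y n)) \<longlonglongrightarrow> T p"
      by (rule LIM_zero_cancel[OF tendsto_norm_zero_cancel])
    have coord: "f j (T x) = (1/2) ^ j * norm (w j) * f j x" for j x
    proof -
      have "f j (T x) = (\<Sum>k. f j (f k x *\<^sub>R v k))"
        unfolding T_def by (rule bounded_linear.suminf[OF bl sT])
      also have "\<dots> = (\<Sum>k\<in>{j}. f j (f k x *\<^sub>R v k))"
        by (rule suminf_finite) (auto simp: v_def linear_scale[OF f(1)] f0)
      finally show ?thesis by (simp add: v_def linear_scale[OF f(1)] f(5))
    qed
    have low: "d / M \<le> f j p" for j
    proof -
      have "(1/2) ^ j * norm (w j) \<noteq> 0" using d(1) d(2)[of j] by auto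
      moreover have "(\<lambda>n. (1/2) ^ j * norm (w j) * f j (y n)) \<longlonglongrightarrow> (1/2) ^ j * norm (w j) * f j p"
        using bounded_linear.tendsto[OF bl lim, of j] by (simp only: coord)
      ultimately have "(\<lambda>n. f j (y n)) \<longlonglongrightarrow> f j p"
        by (simp add: tendsto_mult_left_iff)
      \<comment> \<open>The index starts at \<open>Suc j\<close> because \<open>w j\<close> lies
        below \<open>z (Suc j)\<close>; the divisor \<open>M\<close> comes from scaling
        \<open>z\<close> into the unit ball.\<close>
      moreover have "d / M \<le> f j (y n)" if "n \<ge> Suc j" for n
      proof -
        have "w j \<le> z n" using w(2)[of j] incseqD[OF z(1) that] by (rule order_trans)
        then have "0 \<le> f j (z n - w j)" by (intro f(2)) simp
        then have "d \<le> f j (z n)" using d(2)[of j] by (simp add: linear_diff[OF f(1)] f(5))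
        then show ?thesis using M(1) by (simp add: y_def linear_scale[OF f(1)] field_simps)
      qed
      ultimately show ?thesis by (intro LIMSEQ_le_const) blast+
    qed
    \<comment> \<open>The carrier norm depends on the positive part alone, so \<open>p\<close> may
      be replaced by \<open>pprt p\<close>, to which the decay for positive elements
      applies.\<close>
    have "(\<lambda>j. carrier_norm (w j) (pprt p)) \<longlonglongrightarrow> 0"
      by (rule carrier_norm_tendsto_0[OF oc w(1,3)]) simp_all
    moreover have "d / M \<le> carrier_norm (w j) (pprt p)" for j
      using low[of j] f(4)[of j p] by (simp add: carrier_norm_def)
    ultimately have "d / M \<le> 0" by (intro LIMSEQ_le_const) auto
    then show False using d(1) M(1) by (simp add: field_simps)
  qed
  ultimately show ?thesis by (rule that)
qed

theorem theorem2:
  assumes "order_continuous_norm TYPE('a::banach_lattice)"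
  shows "(KB_space TYPE('a) \<longleftrightarrow>
            (\<forall>T :: 'a \<Rightarrow> 'a. bounded_linear T \<longrightarrow> KB_operator T)) \<and>
         (KB_space TYPE('a) \<longleftrightarrow>
            (\<forall>T :: 'a \<Rightarrow> 'a. positive_operator T \<longrightarrow> KB_operator T)) \<and>
         (KB_space TYPE('a) \<longleftrightarrow>
            (\<forall>T :: 'a \<Rightarrow> 'a. positive_operator T \<and> weakly_compact_operator T \<longrightarrow> KB_operator T)) \<and>
         (KB_space TYPE('a) \<longleftrightarrow>
            (\<forall>T :: 'a \<Rightarrow> 'a. positive_operator T \<and> compact_operator T \<longrightarrow> KB_operator T))"
proof (cases "KB_space TYPE('a)")
  case True
  then show ?thesis
    using KB_space_imp_KB_operator by (auto simp: positive_operator_def)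
next
  case False
  \<comment> \<open>This single operator belongs to all four classes and refutes the four conditions
    at once.\<close>
  obtain T :: "'a \<Rightarrow> 'a" where "positive_operator T" "compact_operator T" "\<not> KB_operator T"
    using not_KB_space_imp_compact_not_KB[OF assms False] by blast
  moreover from this have "bounded_linear T" "weakly_compact_operator T"
    by (auto simp: positive_operator_def intro: compact_operator_imp_weakly_compact)
  ultimately show ?thesis using False by blast
qed

end
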